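(* Let $Q$ be a quiver, $G$ a multigraph, and $\phi:U(Q)\to G$ a morphism in $\mathfrak{M}$. Then there is a unique quiver morphism $\hat\phi:Q\to\overrightarrow{D}(G)$ such that $\theta_G\circ U(\hat\phi)=\phi$.
   Context: A quiver $Q$ consists of sets $\overrightarrow{V}(Q)$, $\overrightarrow{E}(Q)$ and functions $\sigma_Q,\tau_Q:\overrightarrow{E}(Q)\to\overrightarrow{V}(Q)$; morphisms are pairs of functions on vertices and edges commuting with $\sigma$ and $\tau$ (category $\mathfrak{Q}$). A set-system hypergraph $G$ consists of sets $V(G)$, $E(G)$ and $\epsilon_G:E(G)\to\mathcal{P}(V(G))$; morphisms are pairs $(E(\phi),V(\phi))$ with $\epsilon_H\circ E(\phi)=\mathcal{P}V(\phi)\circ\epsilon_G$ ($\mathcal{P}f(A)$ the image). A multigraph is a set-system hypergraph with $1\le|\epsilon_G(e)|\le2$ for all $e$; $\mathfrak{M}$ is the full subcategory of multigraphs. The functor $U:\mathfrak{Q}\to\mathfrak{M}$ sends $Q$ to the multigraph with vertex set $\overrightarrow{V}(Q)$, edge set $\overrightarrow{E}(Q)$ and $\epsilon_{U(Q)}(e)=\{\sigma_Q(e),\tau_Q(e)\}$, and is the identity on the underlying functions of morphisms. For a multigraph $G$, $\overrightarrow{D}(G)$ is the quiver with vertex set $V(G)$, edge set $\{(e,v,w):\epsilon_G(e)=\{v,w\},v\ne w\}\cup\{(e,v,v):\epsilon_G(e)=\{v\}\}$, source $(e,v,w)\mapsto v$ and target $(e,v,w)\mapsto w$. The morphism $\theta_G:U\overrightarrow{D}(G)\to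 G$ is the identity on vertices and $(e,v,w)\mapsto e$ on edges. *)

theory Defs
  imports "Graph_Theory.Digraph" "HOL-Library.FuncSet"
begin

text \<open>
  A quiver is a \<^locale>\<open>wf_digraph\<close>: a \<^typ>\<open>('v, 'e) pre_digraph\<close> whose
  \<^const>\<open>tail\<close> (the source map) and \<^const>\<open>head\<close> (the target map) send arcs to
  vertices. No finiteness is assumed, and loops and parallel arcs are allowed.
\<close>

record ('v, 'e) hypergraph =
  hverts :: "'v set"
  hedges :: "'e set"
  inc :: "'e \<Rightarrow> 'v set"

definition set_system_hypergraph :: "('v, 'e) hypergraph \<Rightarrow> bool" where
  "set_system_hypergraph G \<longleftrightarrow> inc G \<in> hedges G \<rightarrow> Pow (hverts G)"

text \<open>Since \<^const>\<open>card\<close> is 0 on infinite sets, the lower bound also excludes infinite edges.\<close>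

definition multigraph :: "('v, 'e) hypergraph \<Rightarrow> bool" where
  "multigraph G \<longleftrightarrow> set_system_hypergraph G \<and>
     (\<forall>e\<in>hedges G. 1 \<le> card (inc G e) \<and> card (inc G e) \<le> 2)"

text \<open>
  Morphisms, of quivers and of hypergraphs alike, are pairs of functions between the
  carriers. The functions are taken extensional, i.e. \<^const>\<open>undefined\<close> outside their
  domain, so that HOL equality is equality of morphisms. Composition therefore restricts
  to the carriers of the source.
\<close>

record ('v, 'e, 'w, 'f) graph_map =
  vmap :: "'v \<Rightarrow> 'w"
  emap :: "'e \<Rightarrow> 'f"

definition quiver_hom ::
    "('v, 'e) pre_digraph \<Rightarrow> ('w, 'f) pre_digraph \<Rightarrow> ('v, 'e, 'w, 'f) graph_map \<Rightarrow> bool" where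
  "quiver_hom Q R \<phi> \<longleftrightarrow>
     vmap \<phi> \<in> verts Q \<rightarrow>\<^sub>E verts R \<and>
     emap \<phi> \<in> arcs Q \<rightarrow>\<^sub>E arcs R \<and>
     (\<forall>e\<in>arcs Q. tail R (emap \<phi> e) = vmap \<phi> (tail Q e)) \<and>
     (\<forall>e\<in>arcs Q. head R (emap \<phi> e) = vmap \<phi> (head Q e))"

text \<open>Multigraphs form a full subcategory, so their morphisms are the hypergraph morphisms.\<close>

definition hypergraph_hom ::
    "('v, 'e) hypergraph \<Rightarrow> ('w, 'f) hypergraph \<Rightarrow> ('v, 'e, 'w, 'f) graph_map \<Rightarrow> bool" where
  "hypergraph_hom G H \<phi> \<longleftrightarrow>
     vmap \<phi> \<in> hverts G \<rightarrow>\<^sub>E hverts H \<and>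
     emap \<phi> \<in> hedges G \<rightarrow>\<^sub>E hedges H \<and>
     (\<forall>e\<in>hedges G. inc H (emap \<phi> e) = vmap \<phi> ` inc G e)"

definition hypergraph_comp ::
    "('u, 'd) hypergraph \<Rightarrow> ('v, 'e, 'w, 'f) graph_map \<Rightarrow> ('u, 'd, 'v, 'e) graph_map
      \<Rightarrow> ('u, 'd, 'w, 'f) graph_map" where
  "hypergraph_comp G \<psi> \<phi> =
     \<lparr>vmap = compose (hverts G) (vmap \<psi>) (vmap \<phi>),
      emap = compose (hedges G) (emap \<psi>) (emap \<phi>)\<rparr>"

definition U_obj :: "('v, 'e) pre_digraph \<Rightarrow> ('v, 'e) hypergraph" where
  "U_obj Q = \<lparr>hverts = verts Q, hedges = arcs Q, inc = (\<lambda>e. {tail Q e, head Q e})\<rparr>"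

definition U_map :: "('v, 'e, 'w, 'f) graph_map \<Rightarrow> ('v, 'e, 'w, 'f) graph_map" where
  "U_map \<phi> = \<phi>"

definition D_obj :: "('v, 'e) hypergraph \<Rightarrow> ('v, 'e \<times> 'v \<times> 'v) pre_digraph" where
  "D_obj G =
     \<lparr>verts = hverts G,
      arcs = {(e, v, w) | e v w. e \<in> hedges G \<and> inc G e = {v, w} \<and> v \<noteq> w} \<union>
             {(e, v, v) | e v. e \<in> hedges G \<and> inc G e = {v}},
      tail = (\<lambda>(e, v, w). v),
      head = (\<lambda>(e, v, w). w)\<rparr>"

definition \<theta> :: "('v, 'e) hypergraph \<Rightarrow> ('v, 'e \<times> 'v \<times> 'v, 'v, 'e) graph_map" where
  "\<theta> G =
     \<lparr>vmap = (\<lambda>v\<in>hverts (U_obj (D_obj G)). v),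
      emap = (\<lambda>a\<in>hedges (U_obj (D_obj G)). case a of (e, v, w) \<Rightarrow> e)\<rparr>"

lemma multigraph_U_obj:
  assumes "wf_digraph Q"
  shows "multigraph (U_obj Q)"
proof -
  interpret wf_digraph Q by fact
  show ?thesis
    by (auto simp: multigraph_def set_system_hypergraph_def U_obj_def card_insert_if)
qed

lemma hypergraph_hom_U_map:
  assumes "quiver_hom Q R \<phi>"
  shows "hypergraph_hom (U_obj Q) (U_obj R) (U_map \<phi>)"
  using assms by (auto simp: quiver_hom_def hypergraph_hom_def U_obj_def U_map_def)

lemma wf_digraph_D_obj:
  assumes "multigraph G"
  shows "wf_digraph (D_obj G)"
proof -
  have inc: "inc G e \<subseteq> hverts G" if "e \<in> hedges G" for e
    using assms that by (auto simp: multigraph_def set_system_hypergraph_def)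
  show ?thesis
  proof
    fix a assume "a \<in> arcs (D_obj G)"
    then obtain e v w where a: "a = (e, v, w)" "e \<in> hedges G" "inc G e = {v, w}"
      by (auto simp: D_obj_def)
    then have "v \<in> hverts G \<and> w \<in> hverts G"
      using inc[of e] by simp
    then show "tail (D_obj G) a \<in> verts (D_obj G)" "head (D_obj G) a \<in> verts (D_obj G)"
      by (simp_all add: a(1) D_obj_def)
  qed
qed

lemma hypergraph_hom_\<theta>:
  assumes "multigraph G"
  shows "hypergraph_hom (U_obj (D_obj G)) G (\<theta> G)"
proof -
  have inc: "inc G e \<subseteq> hverts G" if "e \<in> hedges G" for e
    using assms that by (auto simp: multigraph_def set_system_hypergraph_def)
  have "inc G (emap (\<theta> G) a) = vmap (\<theta> G) ` inc (U_obj (D_obj G)) a"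
    and "emap (\<theta> G) a \<in> hedges G" if a: "a \<in> arcs (D_obj G)" for a
  proof -
    obtain e v w where e: "a = (e, v, w)" "e \<in> hedges G" "inc G e = {v, w}"
      using a by (auto simp: D_obj_def)
    have "v \<in> hverts G" "w \<in> hverts G"
      using inc[OF e(2)] e(3) by simp_all
    moreover have "emap (\<theta> G) a = e"
      using a e(1) by (simp add: \<theta>_def U_obj_def)
    moreover have "tail (D_obj G) a = v" "head (D_obj G) a = w"
      by (simp_all add: e(1) D_obj_def)
    ultimately show "inc G (emap (\<theta> G) a) = vmap (\<theta> G) ` inc (U_obj (D_obj G)) a"
      and "emap (\<theta> G) a \<in> hedges G"
      using e(2,3) by (simp_all add: \<theta>_def U_obj_def D_obj_def)
  qed
  moreover have "vmap (\<theta> G) \<in> hverts G \<rightarrow>\<^sub>E hverts G"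
    by (simp add: \<theta>_def U_obj_def D_obj_def)
  moreover have "emap (\<theta> G) \<in> extensional (arcs (D_obj G))"
    by (simp add: \<theta>_def U_obj_def)
  ultimately show ?thesis
    unfolding hypergraph_hom_def by (simp add: PiE_iff U_obj_def) (simp add: D_obj_def)
qed

lemma hypergraph_hom_hypergraph_comp:
  assumes "set_system_hypergraph G" "hypergraph_hom G H \<phi>" "hypergraph_hom H K \<psi>"
  shows "hypergraph_hom G K (hypergraph_comp G \<psi> \<phi>)"
proof -
  have "inc K (emap \<psi> (emap \<phi> e)) = compose (hverts G) (vmap \<psi>) (vmap \<phi>) ` inc G e"
    if e: "e \<in> hedges G" for e
  proof -
    have "inc G e \<subseteq> hverts G"
      using assms(1) e by (auto simp: set_system_hypergraph_def)
    then have "compose (hverts G) (vmap \<psi>) (vmap \<phi>) ` inc G e = vmap \<psi> ` vmap \<phi> ` inc G e"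
      unfolding image_image by (intro image_cong) (auto simp: compose_def)
    moreover have "emap \<phi> e \<in> hedges H"
      using assms(2) e by (auto simp: hypergraph_hom_def)
    ultimately show ?thesis
      using assms(2,3) e by (simp add: hypergraph_hom_def)
  qed
  then show ?thesis
    using assms(2,3) unfolding hypergraph_hom_def hypergraph_comp_def
    by (simp add: PiE_iff) (simp add: compose_def)
qed

end

theory Submission
  imports Defs
begin

text \<open>An arc of \<open>D_obj G\<close> is an edge of \<open>G\<close> with a chosen order of
  its endpoints, and \<open>\<theta> G\<close> forgets that order. Composing with
  \<open>\<theta> G\<close> therefore fixes the vertex map of a lift and the first component of each
  arc's image, while compatibility with \<open>tail\<close> and \<open>head\<close> fixes the other
  two components. This gives uniqueness and dictates the formula for the lift; its values really are
  arcs because \<open>\<phi>\<close> preserves incidence.\<close>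

text \<open>Since \<open>{v, v} = {v}\<close>, the loop and non-loop clauses of \<open>arcs\<close>
  merge, so no later step splits on loops.\<close>

lemma in_arcs_D_obj_iff:
  "(e, v, w) \<in> arcs (D_obj G) \<longleftrightarrow> e \<in> hedges G \<and> inc G e = {v, w}"
  by (auto simp: D_obj_def)

lemma D_obj_simps [simp]:
  "verts (D_obj G) = hverts G"
  "tail (D_obj G) a = fst (snd a)"
  "head (D_obj G) a = snd (snd a)"
  by (simp_all add: D_obj_def split: prod.split)

lemma U_obj_simps [simp]:
  "hverts (U_obj Q) = verts Q"
  "hedges (U_obj Q) = arcs Q"
  "inc (U_obj Q) e = {tail Q e, head Q e}"
  by (simp_all add: U_obj_def)

lemma vmap_\<theta>: "v \<in> hverts G \<Longrightarrow> vmap (\<theta> G) v = v"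
  by (simp add: \<theta>_def)

lemma emap_\<theta>: "a \<in> arcs (D_obj G) \<Longrightarrow> emap (\<theta> G) a = fst a"
  by (simp add: \<theta>_def split: prod.split)

theorem mainTheorem10:
  fixes Q :: "('v, 'e) pre_digraph"
    and G :: "('w, 'f) hypergraph"
    and \<phi> :: "('v, 'e, 'w, 'f) graph_map"
  assumes "wf_digraph Q"
    and "multigraph G"
    and "hypergraph_hom (U_obj Q) G \<phi>"
  shows "\<exists>!\<psi>. quiver_hom Q (D_obj G) \<psi> \<and>
           hypergraph_comp (U_obj Q) (\<theta> G) (U_map \<psi>) = \<phi>"
proof -
  interpret wf_digraph Q by fact
  have \<phi>v: "vmap \<phi> \<in> verts Q \<rightarrow>\<^sub>E hverts G"
    and \<phi>e: "emap \<phi> \<in> arcs Q \<rightarrow>\<^sub>E hedges G"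
    and \<phi>inc: "\<And>e. e \<in> arcs Q \<Longrightarrow>
      inc G (emap \<phi> e) = {vmap \<phi> (tail Q e), vmap \<phi> (head Q e)}"
    using assms(3) by (simp_all add: hypergraph_hom_def)
  \<comment> \<open>The order chosen for the edge \<open>emap \<phi> e\<close> is the one that
    \<open>e\<close> has in \<open>Q\<close>. Restricting to \<open>arcs Q\<close> makes the edge
    map extensional, as \<open>quiver_hom\<close> demands.\<close>
  define lift where "lift =
    \<lparr>vmap = vmap \<phi>,
     emap = (\<lambda>e\<in>arcs Q. (emap \<phi> e, vmap \<phi> (tail Q e), vmap \<phi> (head Q e)))\<rparr>"
  have lift_arc: "(emap \<phi> e, vmap \<phi> (tail Q e), vmap \<phi> (head Q e)) \<in> arcs (D_obj G)"
    if "e \<in> arcs Q" for e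
    using that \<phi>e \<phi>inc by (auto simp: in_arcs_D_obj_iff)
  show ?thesis
  proof (rule ex1I[of _ lift], intro conjI)
    show "quiver_hom Q (D_obj G) lift"
      using \<phi>v lift_arc by (simp add: quiver_hom_def lift_def)
    have "compose (verts Q) (vmap (\<theta> G)) (vmap lift) = vmap \<phi>"
      using \<phi>v by (intro extensionalityI[of _ "verts Q"])
        (auto simp: compose_def lift_def vmap_\<theta> PiE_iff)
    moreover have "compose (arcs Q) (emap (\<theta> G)) (emap lift) = emap \<phi>"
      using \<phi>e lift_arc by (intro extensionalityI[of _ "arcs Q"])
        (auto simp: compose_def lift_def emap_\<theta> PiE_iff)
    ultimately show "hypergraph_comp (U_obj Q) (\<theta> G) (U_map lift) = \<phi>"
      by (simp add: hypergraph_comp_def U_map_def)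
  next
    fix \<psi> assume \<psi>: "quiver_hom Q (D_obj G) \<psi> \<and>
      hypergraph_comp (U_obj Q) (\<theta> G) (U_map \<psi>) = \<phi>"
    then have \<psi>v: "vmap \<psi> \<in> verts Q \<rightarrow>\<^sub>E hverts G"
      and \<psi>e: "emap \<psi> \<in> arcs Q \<rightarrow>\<^sub>E arcs (D_obj G)"
      by (simp_all add: quiver_hom_def)
    have vmap: "vmap \<psi> v = vmap \<phi> v" if "v \<in> verts Q" for v
      using that \<psi> PiE_mem[OF \<psi>v that]
      by (auto simp: hypergraph_comp_def U_map_def compose_def vmap_\<theta>)
    have emap: "emap \<psi> e = (emap \<phi> e, vmap \<phi> (tail Q e), vmap \<phi> (head Q e))"
      if e: "e \<in> arcs Q" for e
    proof (intro prod_eqI)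
      \<comment> \<open>\<open>\<theta> G\<close> is \<open>undefined\<close> off the carriers, so
        \<open>emap_\<theta>\<close> applies only once membership is known.\<close>
      have "emap \<psi> e \<in> arcs (D_obj G)"
        using \<psi>e e by auto
      then show "fst (emap \<psi> e) = fst (emap \<phi> e, vmap \<phi> (tail Q e), vmap \<phi> (head Q e))"
        using e \<psi> by (auto simp: hypergraph_comp_def U_map_def compose_def emap_\<theta>)
    \<comment> \<open>The second and third components are \<open>tail\<close> and
      \<open>head\<close> in \<open>D_obj G\<close>; as \<open>\<psi>\<close> is a quiver morphism,
      they are the images of the ends of \<open>e\<close>, where \<open>\<psi>\<close> agrees with
      \<open>\<phi>\<close>.\<close>
    qed (use e \<psi> in \<open>simp_all add: quiver_hom_def vmap\<close>)
    have "vmap \<psi> = vmap lift"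
      using \<phi>v \<psi>v vmap by (intro extensionalityI[of _ "verts Q"]) (auto simp: lift_def PiE_iff)
    moreover have "emap \<psi> = emap lift"
      using \<psi>e emap by (intro extensionalityI[of _ "arcs Q"]) (auto simp: lift_def PiE_iff)
    ultimately show "\<psi> = lift"
      by simp
  qed
qed

end
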